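(* Almost all graphs have proper connection number $2$; that is, the number of graphs on $n$ labeled vertices that are connected and have $pc(G)=2$, divided by the total number $2^{\binom n2}$ of graphs on these vertices, tends to $1$ as $n\to\infty$.
   Context: All graphs are finite, simple and undirected. In an edge-colored graph (adjacent edges may receive the same color), a path is proper if no two adjacent edges of the path have the same color. For a nontrivial connected graph $G$, the proper connection number $pc(G)$ is the minimum number of colors in an edge-coloring of $G$ such that every two distinct vertices of $G$ are connected by at least one proper path. *)

theory Defs
  imports Complex_Main "Graph_Theory.Graph_Theory"
begin

text \<open>
  A finite simple undirected graph is a \<^locale>\<open>pair_graph\<close>: a finite vertex set together with a
  symmetric irreflexive relation of arcs. An undirected edge is the two-element set underlying a
  pair of mutually reverse arcs. Colours live on undirected edges, so both arcs of an edge
  necessarily get the same colour.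
\<close>

definition edges :: "'a pair_pre_digraph \<Rightarrow> 'a set set" where
  "edges G = {{u, v} | u v. (u, v) \<in> parcs G}"

text \<open>
  In \<^term>\<open>vpath p (with_proj G)\<close> the vertices of \<^term>\<open>p\<close> are pairwise distinct, so the adjacent
  pairs of edges of the path are exactly the pairs of consecutive ones.
\<close>

definition proper_path :: "'a pair_pre_digraph \<Rightarrow> ('a set \<Rightarrow> nat) \<Rightarrow> 'a list \<Rightarrow> bool" where
  "proper_path G c p \<longleftrightarrow>
     vpath p (with_proj G) \<and>
     (\<forall>i. i + 2 < length p \<longrightarrow> c {p ! i, p ! (i + 1)} \<noteq> c {p ! (i + 1), p ! (i + 2)})"

definition proper_connected :: "'a pair_pre_digraph \<Rightarrow> ('a set \<Rightarrow> nat) \<Rightarrow> bool" where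
  "proper_connected G c \<longleftrightarrow>
     (\<forall>u \<in> pverts G. \<forall>v \<in> pverts G. u \<noteq> v \<longrightarrow>
        (\<exists>p. proper_path G c p \<and> hd p = u \<and> last p = v))"

text \<open>
  Only meaningful for connected graphs: for a disconnected graph no colouring qualifies and the
  value of \<^const>\<open>Least\<close> is unspecified.
\<close>

definition pc :: "'a pair_pre_digraph \<Rightarrow> nat" where
  "pc G = (LEAST k. \<exists>c. card (c ` edges G) = k \<and> proper_connected G c)"

definition labeled_graphs :: "nat \<Rightarrow> nat pair_pre_digraph set" where
  "labeled_graphs n = {G. pair_graph G \<and> pverts G = {1..n}}"

lemma pair_graph_iff:
  fixes G :: "'a pair_pre_digraph"
  shows "pair_graph G \<longleftrightarrow>
     finite (pverts G) \<and> parcs G \<subseteq> pverts G \<times> pverts G \<and> sym (parcs G) \<and> irrefl (parcs G)"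
proof
  assume "pair_graph G"
  then interpret pair_graph G .
  show "finite (pverts G) \<and> parcs G \<subseteq> pverts G \<times> pverts G \<and> sym (parcs G) \<and> irrefl (parcs G)"
    using pair_finite_verts pair_sym_arcs pair_no_loops arc_fst_in_verts arc_snd_in_verts
    by (fastforce simp: symmetric_def irrefl_def)
next
  assume *: "finite (pverts G) \<and> parcs G \<subseteq> pverts G \<times> pverts G \<and> sym (parcs G) \<and> irrefl (parcs G)"
  then have "finite (parcs G)"
    by (meson finite_SigmaI finite_subset)
  with * show "pair_graph G"
    by unfold_locales (auto simp: symmetric_def irrefl_def)
qed

lemma card_labeled_graphs: "card (labeled_graphs n) = 2 ^ (n choose 2)"
proof -
  let ?P = "{e. e \<subseteq> {1..n} \<and> card e = 2}"
  have "bij_betw edges (labeled_graphs n) (Pow ?P)"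
  proof (rule bij_betw_byWitness[where f' = "\<lambda>E. \<lparr>pverts = {1..n}, parcs = {(u, v). {u, v} \<in> E}\<rparr>"])
    show "\<forall>G\<in>labeled_graphs n. \<lparr>pverts = {1..n}, parcs = {(u, v). {u, v} \<in> edges G}\<rparr> = G"
    proof
      fix G assume "G \<in> labeled_graphs n"
      then have v: "pverts G = {1..n}" and s: "sym (parcs G)"
        by (auto simp: labeled_graphs_def pair_graph_iff)
      have "{(u, v). {u, v} \<in> edges G} = parcs G"
        using s by (auto simp: edges_def doubleton_eq_iff sym_def)
      with v show "\<lparr>pverts = {1..n}, parcs = {(u, v). {u, v} \<in> edges G}\<rparr> = G"
        by simp
    qed
    show "\<forall>E\<in>Pow ?P. edges \<lparr>pverts = {1..n}, parcs = {(u, v). {u, v} \<in> E}\<rparr> = E"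
      by (auto simp: edges_def card_2_iff subset_iff) (metis (no_types, lifting))
    show "edges ` labeled_graphs n \<subseteq> Pow ?P"
      by (fastforce simp: labeled_graphs_def pair_graph_iff edges_def irrefl_def card_insert_if)
    show "(\<lambda>E. \<lparr>pverts = {1..n}, parcs = {(u, v). {u, v} \<in> E}\<rparr>) ` Pow ?P \<subseteq> labeled_graphs n"
    proof (rule image_subsetI)
      fix E assume "E \<in> Pow ?P"
      then have "{u, v} \<in> E \<Longrightarrow> {u, v} \<subseteq> {1..n} \<and> card {u, v} = 2" for u v
        by blast
      then have E: "u \<in> {1..n} \<and> v \<in> {1..n} \<and> u \<noteq> v" if "{u, v} \<in> E" for u v
        using that by (fastforce simp: card_insert_if)
      have "{(u, v). {u, v} \<in> E} \<subseteq> {1..n} \<times> {1..n}"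
        using E by blast
      moreover have "irrefl {(u, v). {u, v} \<in> E}"
        using E by (blast intro: irreflI)
      moreover have "sym {(u, v). {u, v} \<in> E}"
        by (auto intro!: symI simp: insert_commute)
      ultimately show "\<lparr>pverts = {1..n}, parcs = {(u, v). {u, v} \<in> E}\<rparr> \<in> labeled_graphs n"
        unfolding labeled_graphs_def pair_graph_iff by simp
    qed
  qed
  then have "card (labeled_graphs n) = card (Pow ?P)"
    by (rule bij_betw_same_card)
  also have "\<dots> = 2 ^ (n choose 2)"
    using n_subsets[of "{1..n}" 2] by (simp add: card_Pow)
  finally show ?thesis .
qed

end

theory Submission
  imports Defs "HOL-Real_Asymp.Real_Asymp"
begin

text \<open>
  Colour the edges of a uniformly random graph with two colours, uniformly at random. For fixed
  vertices \<open>u \<noteq> v\<close>, each of the other \<open>n - 2\<close> vertices is, independently and with probability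
  \<open>1/8\<close>, the middle of a proper path of length two from \<open>u\<close> to \<open>v\<close>. By the union bound, with
  probability at least \<open>1 - n\<^sup>2 (7/8)\<^sup>n\<^sup>-\<^sup>2\<close> all pairs are joined by such paths, so at least
  this fraction of all graphs has \<open>pc \<le> 2\<close>; and only complete graphs have \<open>pc \<le> 1\<close>.
\<close>

section \<open>From two-step proper colourings to proper connection number 2\<close>

definition two_step_proper :: "'a pair_pre_digraph \<Rightarrow> ('a set \<Rightarrow> bool) \<Rightarrow> bool" where
  "two_step_proper G c \<longleftrightarrow>
     (\<forall>u\<in>pverts G. \<forall>v\<in>pverts G. u \<noteq> v \<longrightarrow>
        (\<exists>w. (u, w) \<in> parcs G \<and> (w, v) \<in> parcs G \<and> c {u, w} \<noteq> c {w, v}))"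

lemma finite_edges: "pair_graph G \<Longrightarrow> finite (edges G)"
proof -
  assume "pair_graph G"
  then have "finite (parcs G)"
    unfolding pair_graph_iff by (meson finite_SigmaI finite_subset)
  moreover have "edges G = (\<lambda>(u, v). {u, v}) ` parcs G"
    by (auto simp: edges_def)
  ultimately show ?thesis by simp
qed

text \<open>A proper path between nonadjacent vertices has at least two edges, and its first two
  edges already carry different colours.\<close>

lemma proper_connected_imp_two_le:
  assumes G: "pair_graph G" and c: "proper_connected G c"
    and uv: "u \<in> pverts G" "v \<in> pverts G" "u \<noteq> v" "(u, v) \<notin> parcs G"
  shows "2 \<le> card (c ` edges G)"
proof -
  obtain p where p: "proper_path G c p" "hd p = u" "last p = v"
    using c uv unfolding proper_connected_def by blast
  then have vp: "vpath p (with_proj G)"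
    by (simp add: proper_path_def)
  then have "p \<noteq> []" by (auto simp: vpath_def vwalk_def)
  with p uv obtain b q where q: "p = u # b # q"
    by (cases p; cases "tl p") auto
  \<comment> \<open>A path \<open>[u, b]\<close> would end in \<open>b = v\<close> and make
    \<open>(u, v)\<close> an arc, so there is a third vertex.\<close>
  with p vp uv obtain d q' where q': "q = d # q'"
    by (cases q) (auto simp: vpath_def vwalk_def)
  have 1: "{u, b} \<in> edges G" "{b, d} \<in> edges G"
    using vp unfolding q q' by (auto simp: vpath_def vwalk_def edges_def)
  have "c {u, b} \<noteq> c {b, d}"
    using p(1)[unfolded proper_path_def, THEN conjunct2, rule_format, of 0] unfolding q q' by simp
  then have "2 = card (c ` {{u, b}, {b, d}})" by simp
  also have "\<dots> \<le> card (c ` edges G)"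
    using 1 finite_edges[OF G] by (intro card_mono) auto
  finally show ?thesis .
qed

lemma two_step_proper_imp_proper_connected:
  assumes G: "pair_graph G" and c: "two_step_proper G c"
  shows "proper_connected G (\<lambda>e. of_bool (c e))"
  unfolding proper_connected_def
proof (intro ballI impI)
  fix u v assume uv: "u \<in> pverts G" "v \<in> pverts G" "u \<noteq> v"
  then obtain w where w: "(u, w) \<in> parcs G" "(w, v) \<in> parcs G" "c {u, w} \<noteq> c {w, v}"
    using c unfolding two_step_proper_def by blast
  then have "w \<in> pverts G" "u \<noteq> w" "w \<noteq> v"
    using G by (auto simp: pair_graph_iff irrefl_def)
  then have "proper_path G (\<lambda>e. of_bool (c e)) [u, w, v]"
    using uv w by (auto simp: proper_path_def vpath_def vwalk_def)
  then show "\<exists>p. proper_path G (\<lambda>e. of_bool (c e)) p \<and> hd p = u \<and> last p = v"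
    by (intro exI[of _ "[u, w, v]"]) auto
qed

text \<open>The boolean colouring gives the upper bound. The nonadjacent pair rules out complete
  graphs and gives the lower bound for every properly connecting colouring.\<close>

lemma two_step_proper_imp_pc_eq_2:
  assumes G: "pair_graph G" and c: "two_step_proper G c"
    and uv: "u \<in> pverts G" "v \<in> pverts G" "u \<noteq> v" "(u, v) \<notin> parcs G"
  shows "pc G = 2"
  unfolding pc_def
proof (rule Least_equality)
  let ?c = "\<lambda>e. of_bool (c e) :: nat"
  have pc: "proper_connected G ?c"
    using G c by (rule two_step_proper_imp_proper_connected)
  \<comment> \<open>\<open>pc\<close> counts the colours actually used, so the bound from above must
    meet the bound from the nonadjacent pair to give exactly 2.\<close>
  have "card (?c ` edges G) \<le> card {0, 1 :: nat}"
    by (intro card_mono) auto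
  then show "\<exists>c. card (c ` edges G) = 2 \<and> proper_connected G c"
    using proper_connected_imp_two_le[OF G pc uv] pc by (intro exI[of _ ?c]) auto
qed (use proper_connected_imp_two_le[OF G _ uv] in blast)

lemma two_step_proper_imp_connected:
  assumes G: "pair_graph G" and c: "two_step_proper G c" and ne: "pverts G \<noteq> {}"
  shows "Digraph_Component.connected (with_proj G)"
proof -
  interpret pair_graph G by fact
  have "u \<rightarrow>\<^sup>*\<^bsub>with_proj G\<^esub> v" if uv: "u \<in> pverts G" "v \<in> pverts G" for u v
  proof (cases "u = v")
    case False
    then obtain w where "(u, w) \<in> parcs G" "(w, v) \<in> parcs G"
      using c uv unfolding two_step_proper_def by blast
    then show ?thesis
      by (meson reachable_adjI reachable_trans)
  qed (use uv in simp)
  then show ?thesis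
    using ne by (intro connectedI) (auto intro: reachable_mk_symmetricI)
qed

section \<open>Counting failures in the product model\<close>

definition vertex_pairs :: "'a set \<Rightarrow> 'a set set" where
  "vertex_pairs V = {e. e \<subseteq> V \<and> card e = 2}"

lemma doubleton_in_vertex_pairs:
  "{u, v} \<in> vertex_pairs V \<longleftrightarrow> u \<in> V \<and> v \<in> V \<and> u \<noteq> v"
  by (auto simp: vertex_pairs_def card_insert_if)

lemma finite_vertex_pairs: "finite V \<Longrightarrow> finite (vertex_pairs V)"
  by (simp add: vertex_pairs_def)

lemma card_vertex_pairs: "finite V \<Longrightarrow> card (vertex_pairs V) = card V choose 2"
  unfolding vertex_pairs_def by (rule n_subsets)

text \<open>
  A pair \<open>(graph, colouring)\<close> is encoded as a function from vertex pairs to \<^typ>\<open>bool \<times> bool\<close>: the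
  first component tells whether the pair is an edge, the second is its colour. Non-edges are
  coloured too, which makes the model a product of uniform distributions.
\<close>

definition two_step :: "('a set \<Rightarrow> bool \<times> bool) \<Rightarrow> 'a \<Rightarrow> 'a \<Rightarrow> 'a \<Rightarrow> bool" where
  "two_step f u v w \<longleftrightarrow>
     fst (f {u, w}) \<and> fst (f {v, w}) \<and> snd (f {u, w}) \<noteq> snd (f {v, w})"

text \<open>Different \<open>w\<close> involve disjoint sets of two vertex pairs, so their
  conditions are independent: each \<open>w\<close> leaves 14 of 16 values, the fraction 7/8, and
  all other pairs are free.\<close>

lemma card_not_two_step:
  assumes V: "finite V" and uv: "u \<in> V" "v \<in> V" "u \<noteq> v"
  shows "real (card {f \<in> vertex_pairs V \<rightarrow>\<^sub>E UNIV. \<forall>w\<in>V - {u, v}. \<not> two_step f u v w})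
           \<le> 4 ^ (card V choose 2) * (7/8) ^ (card V - 2)"
proof -
  define W where "W = V - {u, v}"
  define P where "P = vertex_pairs V"
  define Q where "Q = (\<lambda>w. {u, w}) ` W \<union> (\<lambda>w. {v, w}) ` W"
  \<comment> \<open>The values on \<open>{u, w}\<close> and \<open>{v, w}\<close> for which
    \<open>w\<close> is not a proper middle. Only the two combinations with both edges present and
    different colours are excluded.\<close>
  define B where "B = {(x :: bool \<times> bool, y :: bool \<times> bool). \<not> (fst x \<and> fst y \<and> snd x \<noteq> snd y)}"
  define m where "m = card V - 2"
  have [simp]: "finite W" "finite P"
    using V by (auto simp: W_def P_def finite_vertex_pairs)
  have m: "card W = m"
    using uv V by (simp add: W_def m_def card_Diff_subset)
  have "inj_on (\<lambda>w. {u, w}) W" "inj_on (\<lambda>w. {v, w}) W"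
    by (auto simp: inj_on_def doubleton_eq_iff)
  \<comment> \<open>An equality \<open>{u, w} = {v, w'}\<close> with \<open>u \<noteq> v\<close>
    would force \<open>w = v\<close>, which \<open>W\<close> excludes.\<close>
  moreover have "(\<lambda>w. {u, w}) ` W \<inter> (\<lambda>w. {v, w}) ` W = {}"
    using uv by (auto simp: W_def doubleton_eq_iff)
  ultimately have Q: "card Q = 2 * m"
    unfolding Q_def by (subst card_Un_disjoint) (auto simp: card_image m)
  have QP: "Q \<subseteq> P"
    using uv by (auto simp: Q_def P_def W_def doubleton_in_vertex_pairs)
  have N: "card P = card V choose 2"
    using V by (simp add: P_def card_vertex_pairs)
  have le: "2 * m \<le> card P"
    using card_mono[OF _ QP] Q by simp
  have "B = UNIV - {((True, True), (True, False)), ((True, False), (True, True))}"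
    by (auto simp: B_def)
  then have B: "card B = 14"
    by (simp add: card_Diff_subset card_UNIV_bool flip: UNIV_Times_UNIV)
  \<comment> \<open>Splits \<open>f\<close> into its free values outside \<open>Q\<close> and one
    constrained couple of values per \<open>w\<close>. Injectivity is enough for an upper
    bound.\<close>
  define \<Phi> where "\<Phi> = (\<lambda>f :: 'a set \<Rightarrow> bool \<times> bool. (restrict f (P - Q), \<lambda>w\<in>W. (f {u, w}, f {v, w})))"
  let ?S = "{f \<in> P \<rightarrow>\<^sub>E UNIV. \<forall>w\<in>W. \<not> two_step f u v w}"
  have "inj_on \<Phi> ?S"
  proof (rule inj_onI)
    fix f g assume f: "f \<in> ?S" and g: "g \<in> ?S" and eq: "\<Phi> f = \<Phi> g"
    have 1: "f e = g e" if "e \<in> P - Q" for e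
      using fun_cong[OF conjunct1[OF eq[unfolded \<Phi>_def prod.inject]], of e] that by simp
    have 2: "f {u, w} = g {u, w} \<and> f {v, w} = g {v, w}" if "w \<in> W" for w
      using fun_cong[OF conjunct2[OF eq[unfolded \<Phi>_def prod.inject]], of w] that by simp
    have "f e = g e" if "e \<in> P" for e
      using 1 2 that by (cases "e \<in> Q") (auto simp: Q_def)
    then show "f = g"
      using f g by (auto intro: PiE_ext)
  qed
  moreover have "\<Phi> ` ?S \<subseteq> ((P - Q) \<rightarrow>\<^sub>E UNIV) \<times> (W \<rightarrow>\<^sub>E B)"
    by (auto simp: \<Phi>_def B_def two_step_def)
  ultimately have "card ?S \<le> card (((P - Q) \<rightarrow>\<^sub>E (UNIV :: (bool \<times> bool) set)) \<times> (W \<rightarrow>\<^sub>E B))"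
    by (intro card_inj_on_le) (auto intro!: finite_PiE finite_cartesian_product)
  also have "\<dots> = 4 ^ (card P - 2 * m) * 14 ^ m"
    using QP by (simp add: card_cartesian_product card_PiE B m Q card_Diff_subset finite_subset
        card_UNIV_bool flip: UNIV_Times_UNIV)
  finally have "real (card ?S) \<le> real (4 ^ (card P - 2 * m) * 14 ^ m)"
    by (rule of_nat_mono)
  also have "\<dots> = 4 ^ card P * (7/8) ^ m"
  proof -
    \<comment> \<open>The inequality \<open>2 * m \<le> card P\<close> keeps the natural subtraction
      from truncating.\<close>
    have "(4 :: real) ^ card P = 4 ^ (card P - 2 * m) * 16 ^ m"
      using le power_add[of "4 :: real" "card P - 2 * m" "2 * m"] by (simp add: power_mult)
    moreover have "(16 :: real) ^ m * (7/8) ^ m = 14 ^ m"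
      by (simp flip: power_mult_distrib)
    ultimately show ?thesis by simp
  qed
  finally show ?thesis
    unfolding N by (simp add: P_def W_def m_def)
qed

definition two_step_fails :: "'a set \<Rightarrow> ('a set \<Rightarrow> bool \<times> bool) set" where
  "two_step_fails V = {f \<in> vertex_pairs V \<rightarrow>\<^sub>E UNIV.
     \<exists>u\<in>V. \<exists>v\<in>V. u \<noteq> v \<and> (\<forall>w\<in>V - {u, v}. \<not> two_step f u v w)}"

lemma finite_two_step_fails: "finite V \<Longrightarrow> finite (two_step_fails V)"
  unfolding two_step_fails_def
  by (rule finite_subset[of _ "vertex_pairs V \<rightarrow>\<^sub>E UNIV"])
    (auto intro!: finite_PiE finite_vertex_pairs)

text \<open>Union bound over the ordered pairs of distinct vertices, each contributing the bound of
  \<open>card_not_two_step\<close>.\<close>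

lemma card_two_step_fails:
  assumes V: "finite V"
  shows "real (card (two_step_fails V))
           \<le> (card V)\<^sup>2 * (4 ^ (card V choose 2) * (7/8) ^ (card V - 2))"
proof -
  define S where "S u v = {f \<in> vertex_pairs V \<rightarrow>\<^sub>E UNIV. \<forall>w\<in>V - {u, v}. \<not> two_step f u v w}" for u v
  define I where "I = {(u, v). u \<in> V \<and> v \<in> V \<and> u \<noteq> v}"
  have sub: "I \<subseteq> V \<times> V" by (auto simp: I_def)
  then have [simp]: "finite I" and I: "card I \<le> (card V)\<^sup>2"
    using V card_mono[OF _ sub] by (auto simp: finite_subset card_cartesian_product power2_eq_square)
  have "two_step_fails V = (\<Union>(u, v)\<in>I. S u v)"
    by (auto simp: two_step_fails_def S_def I_def)
  then have "card (two_step_fails V) \<le> (\<Sum>(u, v)\<in>I. card (S u v))"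
    using card_UN_le[of I "\<lambda>(u, v). S u v"] by (simp add: case_prod_unfold)
  then have "real (card (two_step_fails V)) \<le> (\<Sum>(u, v)\<in>I. real (card (S u v)))"
    by (simp add: case_prod_unfold flip: of_nat_sum)
  also have "\<dots> \<le> (\<Sum>_\<in>I. 4 ^ (card V choose 2) * (7/8) ^ (card V - 2))"
    using V by (intro sum_mono) (auto simp: I_def S_def card_not_two_step)
  also have "\<dots> \<le> (card V)\<^sup>2 * (4 ^ (card V choose 2) * (7/8) ^ (card V - 2))"
    using I by (simp del: of_nat_power)
  finally show ?thesis .
qed

section \<open>Transfer of the count to labelled graphs\<close>

lemma edges_eq_iff:
  assumes "sym (parcs G)"
  shows "{u, v} \<in> edges G \<longleftrightarrow> (u, v) \<in> parcs G"
  using assms by (auto simp: edges_def doubleton_eq_iff sym_def)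

text \<open>Allows a graph to be recovered from its encoding, which stores only the edge
  set.\<close>

lemma inj_on_edges: "inj_on edges (labeled_graphs n)"
proof (rule inj_onI)
  fix G H assume G: "G \<in> labeled_graphs n" and H: "H \<in> labeled_graphs n" and "edges G = edges H"
  then have "(u, v) \<in> parcs G \<longleftrightarrow> (u, v) \<in> parcs H" for u v
    using edges_eq_iff[of G u v] edges_eq_iff[of H u v]
    by (simp add: labeled_graphs_def pair_graph_iff)
  then have "parcs G = parcs H" by auto
  with G H show "G = H"
    by (auto simp: labeled_graphs_def)
qed

lemma edges_subset_vertex_pairs: "G \<in> labeled_graphs n \<Longrightarrow> edges G \<subseteq> vertex_pairs {1..n}"
  by (fastforce simp: labeled_graphs_def pair_graph_iff edges_def irrefl_def doubleton_in_vertex_pairs)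

lemma finite_labeled_graphs: "finite (labeled_graphs n)"
  by (rule card_ge_0_finite) (simp add: card_labeled_graphs)

text \<open>Double counting: a graph with no good colouring fails under every colouring, so it
  accounts for \<open>2 ^ (n choose 2)\<close> distinct elements of
  \<open>two_step_fails {1..n}\<close>.\<close>

lemma card_no_two_step_proper:
  "real (card {G \<in> labeled_graphs n. \<nexists>c. two_step_proper G c}) / 2 ^ (n choose 2)
     \<le> (real n)\<^sup>2 * (7/8) ^ (n - 2)"
proof -
  define P where "P = vertex_pairs {1..n}"
  let ?A = "{G \<in> labeled_graphs n. \<nexists>c. two_step_proper G c}"
  \<comment> \<open>Colouring all vertex pairs, not only edges, gives every graph equally many
    colourings.\<close>
  let ?C = "P \<rightarrow>\<^sub>E (UNIV :: bool set)"
  define \<Psi> where "\<Psi> = (\<lambda>(G, c :: nat set \<Rightarrow> bool). \<lambda>e\<in>P. (e \<in> edges G, c e))"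
  have [simp]: "finite P" and P: "card P = n choose 2"
    by (auto simp: P_def finite_vertex_pairs card_vertex_pairs)
  have "inj_on \<Psi> (?A \<times> ?C)"
  proof (rule inj_onI, clarify)
    fix G c H d
    assume G: "G \<in> labeled_graphs n" and H: "H \<in> labeled_graphs n" and c: "c \<in> ?C" and d: "d \<in> ?C"
      and eq: "\<Psi> (G, c) = \<Psi> (H, d)"
    have *: "(e \<in> edges G \<longleftrightarrow> e \<in> edges H) \<and> c e = d e" if "e \<in> P" for e
      using fun_cong[OF eq, of e] that by (simp add: \<Psi>_def)
    then have "edges G = edges H"
      using edges_subset_vertex_pairs[OF G] edges_subset_vertex_pairs[OF H] unfolding P_def by blast
    then have "G = H"
      using inj_onD[OF inj_on_edges _ G H] by blast
    moreover have "c = d"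
      using c d * by (auto intro: PiE_ext)
    ultimately show "G = H \<and> c = d" by simp
  qed
  moreover have "\<Psi> ` (?A \<times> ?C) \<subseteq> two_step_fails {1..n}"
  proof clarify
    fix G c
    assume G: "G \<in> labeled_graphs n" and "\<nexists>c. two_step_proper G c"
    then have c: "\<not> two_step_proper G c" by blast
    from G have vG: "pverts G = {1..n}" and sym: "sym (parcs G)"
      by (auto simp: labeled_graphs_def pair_graph_iff)
    from c obtain u v where uv: "u \<in> {1..n}" "v \<in> {1..n}" "u \<noteq> v"
      and no: "\<not> ((u, w) \<in> parcs G \<and> (w, v) \<in> parcs G \<and> c {u, w} \<noteq> c {w, v})" for w
      by (auto simp: two_step_proper_def vG)
    have "\<not> two_step (\<Psi> (G, c)) u v w" if "w \<in> {1..n} - {u, v}" for w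
    proof -
      have "{u, w} \<in> P" "{v, w} \<in> P"
        using that uv unfolding P_def doubleton_in_vertex_pairs by auto
      then show ?thesis
        \<comment> \<open>\<open>two_step\<close> reads the second edge as \<open>{v, w}\<close>,
          while \<open>two_step_proper\<close> uses the arc \<open>(w, v)\<close>; symmetry
          reconciles the two.\<close>
        using no[of w] symD[OF sym, of v w] symD[OF sym, of w v]
        by (auto simp: two_step_def \<Psi>_def edges_eq_iff[OF sym] insert_commute[of v w])
    qed
    moreover have "\<Psi> (G, c) \<in> vertex_pairs {1..n} \<rightarrow>\<^sub>E UNIV"
      by (simp add: \<Psi>_def P_def)
    ultimately show "\<Psi> (G, c) \<in> two_step_fails {1..n}"
      unfolding two_step_fails_def using uv by blast
  qed
  ultimately have "card (?A \<times> ?C) \<le> card (two_step_fails {1..n})"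
    by (intro card_inj_on_le) (auto intro: finite_two_step_fails)
  then have "real (card (?A \<times> ?C)) \<le> real (card (two_step_fails {1..n}))"
    by (rule of_nat_mono)
  also have "\<dots> \<le> n\<^sup>2 * (4 ^ (n choose 2) * (7/8) ^ (n - 2))"
    using card_two_step_fails[of "{1..n}"] by simp
  finally have "real (card ?A) * 2 ^ (n choose 2) \<le> n\<^sup>2 * (4 ^ (n choose 2) * (7/8) ^ (n - 2))"
    by (simp add: card_cartesian_product card_PiE P card_UNIV_bool)
  \<comment> \<open>Of the two factors of \<open>4 ^ (n choose 2)\<close>, one cancels the number of
    colourings and the other the number of graphs.\<close>
  also have "\<dots> = (real n)\<^sup>2 * (7/8) ^ (n - 2) * 2 ^ (n choose 2) * 2 ^ (n choose 2)"
    by (simp flip: power_mult_distrib)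
  finally show ?thesis
    by (simp add: divide_le_eq)
qed

text \<open>Bounds the exceptional graphs without a nonadjacent pair, to which the lower bound on
  \<open>pc\<close> does not apply.\<close>

lemma complete_labeled_graph_unique:
  "card {G \<in> labeled_graphs n. \<forall>u\<in>{1..n}. \<forall>v\<in>{1..n}. u \<noteq> v \<longrightarrow> (u, v) \<in> parcs G} \<le> 1"
proof -
  have "{G \<in> labeled_graphs n. \<forall>u\<in>{1..n}. \<forall>v\<in>{1..n}. u \<noteq> v \<longrightarrow> (u, v) \<in> parcs G}
          \<subseteq> {\<lparr>pverts = {1..n}, parcs = {(u, v). u \<in> {1..n} \<and> v \<in> {1..n} \<and> u \<noteq> v}\<rparr>}"
  proof clarify
    fix G assume G: "G \<in> labeled_graphs n"
      and "\<forall>u\<in>{1..n}. \<forall>v\<in>{1..n}. u \<noteq> v \<longrightarrow> (u, v) \<in> parcs G"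
    then have "parcs G = {(u, v). u \<in> {1..n} \<and> v \<in> {1..n} \<and> u \<noteq> v}"
      by (auto simp: labeled_graphs_def pair_graph_iff irrefl_def)
    with G show "G = \<lparr>pverts = {1..n}, parcs = {(u, v). u \<in> {1..n} \<and> v \<in> {1..n} \<and> u \<noteq> v}\<rparr>"
      by (simp add: labeled_graphs_def)
  qed
  from card_mono[OF _ this] show ?thesis by simp
qed

section \<open>The limit, by a sandwich argument\<close>

theorem theorem1p6:
  shows "(\<lambda>n. real (card {G \<in> labeled_graphs n.
                Digraph_Component.connected (with_proj G) \<and> pc G = 2})
              / 2 ^ (n choose 2)) \<longlonglongrightarrow> 1"
proof (rule real_tendsto_sandwich)
  define S where "S n = {G \<in> labeled_graphs n.
    Digraph_Component.connected (with_proj G) \<and> pc G = 2}" for n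
  define A where "A n = {G \<in> labeled_graphs n. \<nexists>c. two_step_proper G c}" for n
  define K where "K n = {G \<in> labeled_graphs n.
    \<forall>u\<in>{1..n}. \<forall>v\<in>{1..n}. u \<noteq> v \<longrightarrow> (u, v) \<in> parcs G}" for n
  have lower: "1 - (real n)\<^sup>2 * (7/8) ^ (n - 2) - (1/2) ^ (n - 1)
          \<le> real (card (S n)) / 2 ^ (n choose 2)" if n: "n \<ge> 2" for n
  proof -
    \<comment> \<open>Outside \<open>A n\<close> there is a two-step colouring, and outside
      \<open>K n\<close> a nonadjacent pair; together they give membership in
      \<open>S n\<close>.\<close>
    have "labeled_graphs n \<subseteq> S n \<union> A n \<union> K n"
    proof
      fix G assume G: "G \<in> labeled_graphs n"
      then have G': "pair_graph G" "pverts G = {1..n}"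
        by (auto simp: labeled_graphs_def)
      show "G \<in> S n \<union> A n \<union> K n"
      proof (cases "G \<in> A n \<union> K n")
        case False
        then obtain c u v where "two_step_proper G c" "u \<in> pverts G" "v \<in> pverts G"
          "u \<noteq> v" "(u, v) \<notin> parcs G"
          using G G' by (auto simp: A_def K_def)
        then have "G \<in> S n"
          using G G' two_step_proper_imp_pc_eq_2[of G c u v] two_step_proper_imp_connected[of G c]
          by (auto simp: S_def)
        then show ?thesis by blast
      qed blast
    qed
    then have "card (labeled_graphs n) \<le> card (S n \<union> A n \<union> K n)"
      using finite_labeled_graphs by (intro card_mono) (auto simp: S_def A_def K_def)
    also have "\<dots> \<le> card (S n) + card (A n) + card (K n)"
      by (meson card_Un_le add_le_mono1 order_trans)
    also have "\<dots> \<le> card (S n) + card (A n) + 1"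
      using complete_labeled_graph_unique[of n] by (simp add: K_def)
    finally have "2 ^ (n choose 2) \<le> real (card (S n) + card (A n) + 1)"
      unfolding card_labeled_graphs by (metis of_nat_mono of_nat_numeral of_nat_power)
    then have "1 \<le> (real (card (S n)) + real (card (A n)) + 1) / 2 ^ (n choose 2)"
      by (simp add: le_divide_eq)
    moreover have "real (card (A n)) / 2 ^ (n choose 2) \<le> (real n)\<^sup>2 * (7/8) ^ (n - 2)"
      unfolding A_def by (rule card_no_two_step_proper)
    \<comment> \<open>The share of the complete graph is relaxed to a simpler exponent, since
      \<open>n choose 2\<close> is \<open>n - 1\<close> plus \<open>(n - 1) choose 2\<close> by
      Pascal's rule.\<close>
    moreover have "(1/2 :: real) ^ (n choose 2) \<le> (1/2) ^ (n - 1)"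
    proof (rule power_decreasing)
      obtain m where "n = Suc m" using n by (cases n) auto
      then show "n - 1 \<le> n choose 2" by (simp add: numeral_2_eq_2)
    qed auto
    ultimately show ?thesis
      by (simp add: add_divide_distrib power_one_over)
  qed
  show "\<forall>\<^sub>F n in sequentially. 1 - (real n)\<^sup>2 * (7/8) ^ (n - 2) - (1/2) ^ (n - 1)
          \<le> real (card {G \<in> labeled_graphs n.
                Digraph_Component.connected (with_proj G) \<and> pc G = 2}) / 2 ^ (n choose 2)"
    using eventually_ge_at_top[of 2] by eventually_elim (use lower in \<open>simp add: S_def\<close>)
  have "card (S n) \<le> 2 ^ (n choose 2)" for n
    unfolding card_labeled_graphs[symmetric]
    using finite_labeled_graphs by (intro card_mono) (auto simp: S_def)
  then have "real (card (S n)) / 2 ^ (n choose 2) \<le> 1" for n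
    by (simp add: divide_le_eq)
  then show "\<forall>\<^sub>F n in sequentially. real (card {G \<in> labeled_graphs n.
                Digraph_Component.connected (with_proj G) \<and> pc G = 2}) / 2 ^ (n choose 2) \<le> 1"
    by (simp add: S_def)
  \<comment> \<open>Shifting the index by 2 removes the truncated subtractions \<open>n - 2\<close>
    and \<open>n - 1\<close>; \<open>LIMSEQ_offset\<close> undoes the shift.\<close>
  have "(\<lambda>n. 1 - (real n + 2)\<^sup>2 * (7/8) ^ n) \<longlonglongrightarrow> 1"
    by real_asymp
  moreover have "(\<lambda>n. (1/2 :: real) ^ (n + 1)) \<longlonglongrightarrow> 0"
    by real_asymp
  ultimately have "(\<lambda>n. 1 - (real n + 2)\<^sup>2 * (7/8) ^ n - (1/2) ^ (n + 1)) \<longlonglongrightarrow> 1 - 0"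
    by (rule tendsto_diff)
  then show "(\<lambda>n. 1 - (real n)\<^sup>2 * (7/8) ^ (n - 2) - (1/2) ^ (n - 1)) \<longlonglongrightarrow> 1"
    by - (rule LIMSEQ_offset[where k = 2], simp add: add.commute)
qed simp

end
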